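(* For any prime $p$, $f(3) \leq 4$.
   Context: $\mathbb{Z}_p$ is the ring of $p$-adic integers and $M_n(\mathbb{Z}_p)$ is the ring of $n \times n$ matrices over $\mathbb{Z}_p$. A form $\sum_{i=1}^m a_i X_i^2$ with $a_i \in \mathbb{Z}_p$ is universal over $M_n(\mathbb{Z}_p)$ if for every $A \in M_n(\mathbb{Z}_p)$ there exist $X_1, \ldots, X_m \in M_n(\mathbb{Z}_p)$ with $A = \sum_{i=1}^m a_i X_i^2$. For a fixed prime $p$ and an integer $n \geq 3$, $f(n)$ is the smallest integer $m \geq 3$ such that for all $p$-adic integers $a_1, a_2, \ldots, a_m$ with at least three of them (counted by index) units, the form $\sum_{i=1}^m a_i X_i^2$ is universal over $M_n(\mathbb{Z}_p)$. *)

theory Defs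
  imports
    "Berlekamp_Zassenhaus.Finite_Field"
    "Jordan_Normal_Form.Matrix"
    "HOL-Library.Extended_Nat"
begin

text \<open>
  The prime is \<open>p = CARD('p)\<close>, where the class \<^class>\<open>prime_card\<close> says that
  \<open>CARD('p)\<close> is prime. The ring of \<open>p\<close>-adic integers is the inverse limit of the rings
  \<open>\<int>/p\<^sup>k\<int>\<close>: an element is a compatible sequence of residues, each
  represented by its least non-negative representative.
\<close>

typedef (overloaded) 'p padic_int =
  "{x :: nat \<Rightarrow> int. \<forall>k. 0 \<le> x k \<and> x k < int CARD('p :: prime_card) ^ k \<and>
      x (Suc k) mod int CARD('p) ^ k = x k}"
  morphisms padic_residue Abs_padic_int
  by (rule exI[of _ "\<lambda>_. 0"]) (simp add: prime_card prime_gt_0_nat)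

setup_lifting type_definition_padic_int

lemma card_power_pos: "0 < int CARD('p :: prime_card) ^ k"
  by (simp add: prime_card prime_gt_0_nat)

lemma compatible_mod:
  assumes "y mod (b :: int) ^ k = x mod b ^ k"
  shows "y mod b ^ Suc k mod b ^ k = x mod b ^ k"
  using assms by (simp add: mod_mod_cancel)

instantiation padic_int :: (prime_card) comm_ring_1
begin

lift_definition zero_padic_int :: "'a padic_int" is "\<lambda>_. 0"
  by (simp add: card_power_pos)

lift_definition one_padic_int :: "'a padic_int" is "\<lambda>k. 1 mod int CARD('a) ^ k"
  by (auto simp del: power_Suc simp: card_power_pos intro!: compatible_mod)

lift_definition plus_padic_int :: "'a padic_int \<Rightarrow> 'a padic_int \<Rightarrow> 'a padic_int"
  is "\<lambda>x y k. (x k + y k) mod int CARD('a) ^ k"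
  by (auto simp del: power_Suc simp: card_power_pos intro!: compatible_mod)
    (metis mod_add_eq)

lift_definition minus_padic_int :: "'a padic_int \<Rightarrow> 'a padic_int \<Rightarrow> 'a padic_int"
  is "\<lambda>x y k. (x k - y k) mod int CARD('a) ^ k"
  by (auto simp del: power_Suc simp: card_power_pos intro!: compatible_mod)
    (metis mod_diff_eq)

lift_definition uminus_padic_int :: "'a padic_int \<Rightarrow> 'a padic_int"
  is "\<lambda>x k. (- x k) mod int CARD('a) ^ k"
  by (auto simp del: power_Suc simp: card_power_pos intro!: compatible_mod)
    (metis mod_minus_eq)

lift_definition times_padic_int :: "'a padic_int \<Rightarrow> 'a padic_int \<Rightarrow> 'a padic_int"
  is "\<lambda>x y k. (x k * y k) mod int CARD('a) ^ k"
  by (auto simp del: power_Suc simp: card_power_pos intro!: compatible_mod)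
    (metis mod_mult_eq)

instance
proof
  fix x y z :: "'a padic_int"
  show "x + y + z = x + (y + z)"
    by transfer (simp add: mod_simps algebra_simps)
  show "x + y = y + x"
    by transfer (simp add: add.commute)
  show "0 + x = x"
    by transfer (simp add: fun_eq_iff)
  show "- x + x = 0"
    by transfer (simp add: mod_simps)
  show "x - y = x + - y"
    by transfer (simp add: mod_simps)
  show "x * y * z = x * (y * z)"
    by transfer (simp add: mod_simps mult.assoc)
  show "x * y = y * x"
    by transfer (simp add: mult.commute)
  show "1 * x = x"
    by transfer (simp add: mod_simps fun_eq_iff)
  show "(x + y) * z = x * z + y * z"
    by transfer (simp add: mod_simps distrib_right)
  have "(1 :: int) mod int CARD('a) ^ 1 \<noteq> 0"
    using prime_gt_1_nat[OF prime_card[where 'a = 'a]] by simp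
  then show "(0 :: 'a padic_int) \<noteq> 1"
    by transfer (metis (no_types))
qed

end

definition diag_form :: "nat \<Rightarrow> nat \<Rightarrow> (nat \<Rightarrow> 'a :: comm_ring_1) \<Rightarrow> (nat \<Rightarrow> 'a mat) \<Rightarrow> 'a mat" where
  "diag_form n m a X = mat n n (\<lambda>rc. \<Sum>i<m. (a i \<cdot>\<^sub>m (X i * X i)) $$ rc)"

definition universal :: "nat \<Rightarrow> nat \<Rightarrow> (nat \<Rightarrow> 'a :: comm_ring_1) \<Rightarrow> bool" where
  "universal n m a \<longleftrightarrow>
     (\<forall>A \<in> carrier_mat n n. \<exists>X. (\<forall>i<m. X i \<in> carrier_mat n n) \<and> A = diag_form n m a X)"

text \<open>
  The infimum is taken in \<^typ>\<open>enat\<close>, so the value is \<open>\<infinity>\<close> if no \<open>m\<close> qualifies, and a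
  finite bound includes the existence of such an \<open>m\<close>. The indices of the form run through
  \<open>0, \<dots>, m - 1\<close>.
\<close>

definition f_min :: "'p :: prime_card itself \<Rightarrow> nat \<Rightarrow> enat" where
  "f_min _ n = (INF m \<in> {m. 3 \<le> m \<and>
     (\<forall>a :: nat \<Rightarrow> 'p padic_int. 3 \<le> card {i. i < m \<and> a i dvd 1} \<longrightarrow> universal n m a)}. enat m)"

end

theory Submission
  imports Defs
begin

text \<open>
  Already three unit coefficients \<open>a, b, c\<close> suffice, over any commutative local ring in which every
  element is congruent to 0 or 1 modulo 2. Subtracting a suitable \<open>b Y\<^sup>2\<close> makes the matrix upper
  Hessenberg with unit subdiagonal. Subtracting \<open>a X\<^sup>2\<close>, with \<open>X\<close> an idempotent supported in the
  first row, then leaves two free entries there, and the last two coefficients of the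
  characteristic polynomial depend on them invertibly. So they can be chosen such that
  \<open>1/c\<close> times the remainder has characteristic polynomial
  \<open>s (s + \<beta>)\<^sup>2 - (\<alpha> s + \<alpha> \<beta> + 1)\<^sup>2\<close>, with \<open>\<alpha>\<close> 0 or 1 according to the parity of the trace
  \<open>\<alpha>\<^sup>2 - 2 \<beta>\<close>. By Cayley-Hamilton a matrix \<open>C\<close> with this characteristic polynomial is the square of
  \<open>(\<alpha> C + \<alpha> \<beta> + 1) (C + \<beta>)\<^sup>-\<^sup>1\<close>.
\<close>

section \<open>Units and parity in the p-adic integers\<close>

lemma padic_residue_bounds:
  fixes x :: "'p :: prime_card padic_int"
  shows "0 \<le> padic_residue x k" "padic_residue x k < int CARD('p) ^ k"
    "padic_residue x (Suc k) mod int CARD('p) ^ k = padic_residue x k"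
  using padic_residue[of x] by auto

lemma padic_residue_mod_card:
  fixes x :: "'p :: prime_card padic_int"
  assumes "1 \<le> k"
  shows "padic_residue x k mod int CARD('p) = padic_residue x 1"
  using assms
proof (induction k rule: dec_induct)
  case base
  show ?case using padic_residue_bounds[of x 1] by simp
next
  case (step k)
  have "int CARD('p) dvd int CARD('p) ^ k"
    using step.hyps by (intro dvd_power) auto
  then have "padic_residue x (Suc k) mod int CARD('p)
      = padic_residue x (Suc k) mod int CARD('p) ^ k mod int CARD('p)"
    by (simp add: mod_mod_cancel)
  then show ?case
    using step.IH padic_residue_bounds(3)[of x k] by metis
qed

text \<open>All residues agree modulo p, so a nonzero first one makes each residue invertible modulo
  its power of p. The inverses found level by level fit together because inverses modulo
  \<open>?p ^ k\<close> are unique.\<close>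

lemma padic_int_unit:
  fixes x :: "'p :: prime_card padic_int"
  assumes "padic_residue x 1 \<noteq> 0"
  shows "x dvd 1"
proof -
  let ?p = "int CARD('p)"
  have p: "prime ?p" by (simp add: prime_card)
  have coprime: "coprime (padic_residue x k) (?p ^ k)" for k
  proof (cases "k = 0")
    case False
    then have "padic_residue x k mod ?p \<noteq> 0"
      using assms padic_residue_mod_card[of k x] by simp
    then have "\<not> ?p dvd padic_residue x k" by auto
    then have "coprime ?p (padic_residue x k)" using p by (rule prime_imp_coprime[rotated])
    then show ?thesis by (simp add: coprime_commute)
  qed simp
  have "\<exists>y. \<forall>k. (padic_residue x k * y k) mod ?p ^ k = 1 mod ?p ^ k"
  proof (rule choice, rule allI)
    fix k
    obtain z where "[padic_residue x k * z = 1] (mod ?p ^ k)"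
      using cong_solve_coprime_int[OF coprime] by blast
    then show "\<exists>y. (padic_residue x k * y) mod ?p ^ k = 1 mod ?p ^ k"
      by (auto simp: cong_def)
  qed
  then obtain y where y: "\<And>k. (padic_residue x k * y k) mod ?p ^ k = 1 mod ?p ^ k" by blast
  define z where "z k = y k mod ?p ^ k" for k
  have z: "[padic_residue x k * z k = 1] (mod ?p ^ k)" for k
    using y[of k] by (simp add: z_def cong_def mod_mult_right_eq)
  \<comment> \<open>Modulo \<open>?p ^ k\<close>, both \<open>z (Suc k)\<close> and
    \<open>z k\<close> invert \<open>padic_residue x k\<close>, which can be cancelled.\<close>
  have "z (Suc k) mod ?p ^ k = z k" for k
  proof -
    have "[padic_residue x (Suc k) * z (Suc k) = 1] (mod ?p ^ k)"
      by (rule cong_dvd_modulus[OF z]) simp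
    moreover have "[padic_residue x k = padic_residue x (Suc k)] (mod ?p ^ k)"
      using padic_residue_bounds(3)[of x k] padic_residue_bounds(1,2)[of x k] by (simp add: cong_def)
    ultimately have "[padic_residue x k * z (Suc k) = padic_residue x k * z k] (mod ?p ^ k)"
      using z[of k] by (metis cong_scalar_right cong_sym cong_trans)
    then have "[z (Suc k) = z k] (mod ?p ^ k)"
      using cong_mult_lcancel[OF coprime] by blast
    then show ?thesis by (simp add: cong_def z_def)
  qed
  then have "z \<in> {x. \<forall>k. 0 \<le> x k \<and> x k < ?p ^ k \<and> x (Suc k) mod ?p ^ k = x k}"
    using card_power_pos[where 'p = 'p] by (simp add: z_def)
  then have "padic_residue (Abs_padic_int z :: 'p padic_int) = z"
    by (rule Abs_padic_int_inverse)
  then have "x * Abs_padic_int z = 1"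
    using z by (simp add: padic_residue_inject[symmetric] times_padic_int.rep_eq
        one_padic_int.rep_eq cong_def fun_eq_iff)
  then show ?thesis by (metis dvd_triv_left)
qed

lemma padic_int_unit_iff:
  fixes x :: "'p :: prime_card padic_int"
  shows "x dvd 1 \<longleftrightarrow> padic_residue x 1 \<noteq> 0"
proof
  assume "x dvd 1"
  then obtain y where "1 = x * y" by (auto elim: dvdE)
  then have "padic_residue (1 :: 'p padic_int) 1 = padic_residue (x * y) 1" by simp
  then show "padic_residue x 1 \<noteq> 0"
    using prime_gt_1_nat[OF prime_card[where 'a = 'p]]
    by (auto simp: one_padic_int.rep_eq times_padic_int.rep_eq)
qed (rule padic_int_unit)

text \<open>This is locality: \<open>x\<close> and \<open>x - b\<close> cannot both vanish in the
  residue field when \<open>b\<close> does not. Later \<open>b\<close> is a coefficient of the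
  form.\<close>

lemma padic_int_unit_or_diff_unit:
  fixes x b :: "'p :: prime_card padic_int"
  assumes "b dvd 1"
  shows "x dvd 1 \<or> (x - b) dvd 1"
proof (rule disjCI)
  assume "\<not> (x - b) dvd 1"
  then have "(padic_residue x 1 - padic_residue b 1) mod int CARD('p) = 0"
    by (simp add: padic_int_unit_iff minus_padic_int.rep_eq)
  then have "padic_residue x 1 mod int CARD('p) = padic_residue b 1 mod int CARD('p)"
    by (simp add: mod_eq_dvd_iff mod_eq_0_iff_dvd)
  then show "x dvd 1"
    using assms padic_residue_bounds[of x 1] padic_residue_bounds[of b 1]
    by (simp add: padic_int_unit_iff)
qed

lemma padic_int_card_dvd:
  fixes x :: "'p :: prime_card padic_int"
  assumes "padic_residue x 1 = 0"
  shows "of_nat CARD('p) dvd x"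
proof -
  let ?p = "int CARD('p)"
  have p: "0 < ?p" by (simp add: prime_card prime_gt_0_nat)
  \<comment> \<open>Division by p costs one digit of precision, so level k of the quotient is read
    off level k + 1 of \<open>x\<close>.\<close>
  define y where "y k = padic_residue x (Suc k) div ?p" for k
  have x: "padic_residue x (Suc k) = ?p * y k" for k
    using padic_residue_mod_card[of "Suc k" x] assms by (auto simp: y_def)
  have "y k < ?p ^ k" for k
    using padic_residue_bounds(2)[of x "Suc k"] p by (simp add: x)
  moreover have "0 \<le> y k" for k
    using padic_residue_bounds(1)[of x "Suc k"] p unfolding y_def by (intro pos_imp_zdiv_nonneg_iff[THEN iffD2])
  moreover have "y (Suc k) mod ?p ^ k = y k" for k
  proof -
    have "?p * (y (Suc k) mod ?p ^ k) = ?p * y k"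
      using padic_residue_bounds(3)[of x "Suc k"]
      unfolding x mult_mod_right power_Suc .
    then show ?thesis using p by simp
  qed
  ultimately have "y \<in> {x. \<forall>k. 0 \<le> x k \<and> x k < ?p ^ k \<and> x (Suc k) mod ?p ^ k = x k}"
    by simp
  then have y: "padic_residue (Abs_padic_int y :: 'p padic_int) = y"
    by (rule Abs_padic_int_inverse)
  have of_nat: "padic_residue (of_nat n :: 'p padic_int) k = int n mod ?p ^ k" for n k
    by (induction n) (simp_all add: zero_padic_int.rep_eq one_padic_int.rep_eq
        plus_padic_int.rep_eq mod_simps)
  have "x = of_nat CARD('p) * Abs_padic_int y"
    using y padic_residue_bounds(3)[of x]
    by (simp add: padic_residue_inject[symmetric] times_padic_int.rep_eq of_nat fun_eq_iff
        mod_mult_left_eq x[symmetric])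
  then show ?thesis by (metis dvd_triv_left)
qed

text \<open>For p = 2 the residue field has only the elements 0 and 1; for odd p the number 2 is a
  unit and divides everything.\<close>

lemma padic_int_parity:
  fixes x :: "'p :: prime_card padic_int"
  shows "2 dvd x \<or> 2 dvd x - 1"
proof (cases "CARD('p) = 2")
  case True
  then have two: "2 dvd y" if "padic_residue y 1 = 0" for y :: "'p padic_int"
    using padic_int_card_dvd[OF that] by simp
  have "padic_residue (x - 1) 1 = (padic_residue x 1 - 1) mod 2"
    using True by (simp add: minus_padic_int.rep_eq one_padic_int.rep_eq)
  moreover have "padic_residue x 1 = 0 \<or> padic_residue x 1 = 1"
    using padic_residue_bounds(1,2)[of x 1] True by auto
  ultimately show ?thesis using two[of x] two[of "x - 1"] by auto
next
  case False
  then have "2 < CARD('p)"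
    using prime_gt_1_nat[OF prime_card[where 'a = 'p]] by simp
  then have "padic_residue (1 + 1 :: 'p padic_int) 1 \<noteq> 0"
    unfolding plus_padic_int.rep_eq one_padic_int.rep_eq by simp
  then have "(2 :: 'p padic_int) dvd 1"
    using padic_int_unit by (metis one_add_one)
  then show ?thesis using dvd_trans one_dvd by blast
qed

section \<open>Matrices of size three\<close>

definition mat3 :: "'a \<Rightarrow> 'a \<Rightarrow> 'a \<Rightarrow> 'a \<Rightarrow> 'a \<Rightarrow> 'a \<Rightarrow> 'a \<Rightarrow> 'a \<Rightarrow> 'a \<Rightarrow> 'a mat" where
  "mat3 a b c d e f g h i = mat_of_rows_list 3 [[a, b, c], [d, e, f], [g, h, i]]"

lemma mat3_carrier [simp]: "mat3 a b c d e f g h i \<in> carrier_mat 3 3"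
  by (simp add: mat3_def mat_of_rows_list_def numeral_3_eq_3)

lemma mat3_eqI:
  assumes "a = a'" "b = b'" "c = c'" "d = d'" "e = e'" "f = f'" "g = g'" "h = h'" "i = i'"
  shows "mat3 a b c d e f g h i = mat3 a' b' c' d' e' f' g' h' i'"
  using assms by simp

lemma carrier_mat3:
  assumes "A \<in> carrier_mat 3 3"
  obtains a b c d e f g h i where "A = mat3 a b c d e f g h i"
proof
  show "A = mat3 (A $$ (0,0)) (A $$ (0,1)) (A $$ (0,2)) (A $$ (1,0)) (A $$ (1,1)) (A $$ (1,2))
      (A $$ (2,0)) (A $$ (2,1)) (A $$ (2,2))"
    using assms
    by (intro eq_matI)
      (auto simp: mat3_def mat_of_rows_list_def less_Suc_eq numeral_3_eq_3 numeral_2_eq_2)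
qed

lemma mat3_mult:
  fixes a :: "'a :: comm_ring_1"
  shows "mat3 a b c d e f g h i * mat3 a' b' c' d' e' f' g' h' i' =
    mat3 (a * a' + b * d' + c * g') (a * b' + b * e' + c * h') (a * c' + b * f' + c * i')
      (d * a' + e * d' + f * g') (d * b' + e * e' + f * h') (d * c' + e * f' + f * i')
      (g * a' + h * d' + i * g') (g * b' + h * e' + i * h') (g * c' + h * f' + i * i')"
  by (intro eq_matI)
    (auto simp: mat3_def mat_of_rows_list_def less_Suc_eq numeral_3_eq_3 scalar_prod_def)

lemma mat3_smult:
  "k \<cdot>\<^sub>m mat3 a b c d e f g h i =
    mat3 (k * a) (k * b) (k * c) (k * d) (k * e) (k * f) (k * g) (k * h) (k * i)"
  by (intro eq_matI) (auto simp: mat3_def mat_of_rows_list_def less_Suc_eq numeral_3_eq_3)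

lemma mat3_add:
  "mat3 a b c d e f g h i + mat3 a' b' c' d' e' f' g' h' i' =
    mat3 (a + a') (b + b') (c + c') (d + d') (e + e') (f + f') (g + g') (h + h') (i + i')"
  by (intro eq_matI) (auto simp: mat3_def mat_of_rows_list_def less_Suc_eq numeral_3_eq_3)

lemma diag_form_three:
  assumes "X 0 \<in> carrier_mat 3 3" "X 1 \<in> carrier_mat 3 3" "X 2 \<in> carrier_mat 3 3"
  shows "diag_form 3 3 a X =
    a 0 \<cdot>\<^sub>m (X 0 * X 0) + a 1 \<cdot>\<^sub>m (X 1 * X 1) + a 2 \<cdot>\<^sub>m (X 2 * X 2)"
  using assms by (intro eq_matI) (auto simp: diag_form_def numeral_3_eq_3 numeral_2_eq_2)

section \<open>Universality of forms with three unit coefficients\<close>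

text \<open>
  The root is \<open>\<alpha> + adj T\<close>, where \<open>T\<close> is the given matrix plus \<open>\<beta>\<close>. Every 3 by 3 matrix satisfies
  \<open>(adj T)\<^sup>2 = e\<^sub>2 adj T - e\<^sub>1 det T + det T T\<close>, where \<open>e\<^sub>1\<close> is the trace
  and \<open>e\<^sub>2\<close> the sum of the principal 2 by 2 minors of \<open>T\<close>.
\<close>

lemma mat3_square_root:
  fixes t11 :: "'a :: comm_ring_1"
  assumes e1: "t11 + t22 + t33 = \<beta> + \<alpha> * \<alpha>"
    and e2: "t11 * t22 + t11 * t33 + t22 * t33 - t12 * t21 - t23 * t32 = - 2 * \<alpha>"
    and e3: "t11 * (t22 * t33 - t23 * t32) - t21 * (t12 * t33 - t13 * t32) = 1"
  shows "\<exists>Z \<in> carrier_mat 3 3.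
    Z * Z = mat3 (t11 - \<beta>) t12 t13 t21 (t22 - \<beta>) t23 0 t32 (t33 - \<beta>)"
proof -
  \<comment> \<open>The \<open>u\<close>s are the entries of adj T, where the (3,1) entry of T is
    0.\<close>
  define u11 where "u11 = t22 * t33 - t23 * t32"
  define u12 where "u12 = t13 * t32 - t12 * t33"
  define u13 where "u13 = t12 * t23 - t13 * t22"
  define u21 where "u21 = - t21 * t33"
  define u22 where "u22 = t11 * t33"
  define u23 where "u23 = t13 * t21 - t11 * t23"
  define u31 where "u31 = t21 * t32"
  define u32 where "u32 = - t11 * t32"
  define u33 where "u33 = t11 * t22 - t12 * t21"
  note u_defs = u11_def u12_def u13_def u21_def u22_def u23_def u31_def u32_def u33_def
  define E1 where "E1 = t11 + t22 + t33"
  define E2 where "E2 = t11 * t22 + t11 * t33 + t22 * t33 - t12 * t21 - t23 * t32"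
  define D where "D = t11 * (t22 * t33 - t23 * t32) - t21 * (t12 * t33 - t13 * t32)"
  have adj_square:
    "u11 * u11 + u12 * u21 + u13 * u31 = E2 * u11 - E1 * D + D * t11"
    "u11 * u12 + u12 * u22 + u13 * u32 = E2 * u12 + D * t12"
    "u11 * u13 + u12 * u23 + u13 * u33 = E2 * u13 + D * t13"
    "u21 * u11 + u22 * u21 + u23 * u31 = E2 * u21 + D * t21"
    "u21 * u12 + u22 * u22 + u23 * u32 = E2 * u22 - E1 * D + D * t22"
    "u21 * u13 + u22 * u23 + u23 * u33 = E2 * u23 + D * t23"
    "u31 * u11 + u32 * u21 + u33 * u31 = E2 * u31"
    "u31 * u12 + u32 * u22 + u33 * u32 = E2 * u32 + D * t32"
    "u31 * u13 + u32 * u23 + u33 * u33 = E2 * u33 - E1 * D + D * t33"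
    unfolding u_defs E1_def E2_def D_def by (simp_all add: algebra_simps)
  have invariants: "E1 = \<beta> + \<alpha> * \<alpha>" "E2 = - 2 * \<alpha>" "D = 1"
    using e1 e2 e3 by (simp_all add: E1_def E2_def D_def)
  \<comment> \<open>Here (adj T)^2 = -2 \<alpha> adj T - (\<beta> + \<alpha>^2) + T, so completing
    the square by \<alpha> leaves T - \<beta>.\<close>
  let ?Z = "mat3 (u11 + \<alpha>) u12 u13 u21 (u22 + \<alpha>) u23 u31 u32 (u33 + \<alpha>)"
  have "?Z * ?Z = mat3 (t11 - \<beta>) t12 t13 t21 (t22 - \<beta>) t23 0 t32 (t33 - \<beta>)"
    unfolding mat3_mult
    using adj_square unfolding invariants by (intro mat3_eqI) (simp_all add: algebra_simps)
  then show ?thesis by (metis mat3_carrier)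
qed

text \<open>Subtracting a multiple of an idempotent supported in the first row fixes the trace of
  the remainder but frees its entries (1,2) and (1,3). The units below the diagonal let these two
  entries prescribe the other two invariants.\<close>

lemma hessenberg_two_squares:
  fixes a c :: "'a :: comm_ring_1"
  assumes parity: "\<And>x :: 'a. 2 dvd x \<or> 2 dvd x - 1"
    and a: "a dvd 1" and c: "c dvd 1" and s: "s dvd 1"
  shows "\<exists>X \<in> carrier_mat 3 3. \<exists>Z \<in> carrier_mat 3 3.
    mat3 b11 b12 b13 1 b22 b23 0 s b33 = a \<cdot>\<^sub>m (X * X) + c \<cdot>\<^sub>m (Z * Z)"
proof -
  obtain a' c' s' where inv: "a * a' = 1" "c * c' = 1" "s * s' = 1"
    using a c s by (metis dvdE)
  \<comment> \<open>This is the trace of C, the matrix left after subtracting \<open>a\<close> times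
    the idempotent and dividing by \<open>c\<close>. The \<open>t\<close>s below are the entries of
    T = C + \<beta>.\<close>
  define e where "e = c' * (b11 - a + b22 + b33)"
  obtain \<alpha> \<beta> where e: "e = \<alpha> * \<alpha> - 2 * \<beta>"
  proof -
    consider k where "e = 2 * k" | k where "e - 1 = 2 * k"
      using parity[of e] by (auto elim!: dvdE)
    then show thesis
    proof cases
      case 1
      then show thesis using that[of 0 "- k"] by simp
    next
      case 2
      then have "e = 1 * 1 - 2 * (- k)" by (simp add: algebra_simps)
      then show thesis using that by blast
    qed
  qed
  define t11 where "t11 = c' * (b11 - a) + \<beta>"
  define t22 where "t22 = c' * b22 + \<beta>"
  define t33 where "t33 = c' * b33 + \<beta>"
  define t23 where "t23 = c' * b23"
  define t32 where "t32 = c' * s"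
  \<comment> \<open>The sum of principal minors is affine in \<open>t12\<close> with slope
    \<open>- c'\<close>, which determines \<open>t12\<close>. Then the determinant is affine in
    \<open>t13\<close> with slope \<open>c' * t32\<close>, whose inverse is
    \<open>c * s' * c\<close>.\<close>
  define t12 where "t12 = c * (t11 * t22 + t11 * t33 + t22 * t33 - t23 * t32 + 2 * \<alpha>)"
  define t13 where "t13 = c * s' * c * (1 - t11 * (t22 * t33 - t23 * t32) + c' * t12 * t33)"
  have "\<exists>Z \<in> carrier_mat 3 3.
      Z * Z = mat3 (t11 - \<beta>) t12 t13 c' (t22 - \<beta>) t23 0 t32 (t33 - \<beta>)"
  proof (rule mat3_square_root)
    show "t11 + t22 + t33 = \<beta> + \<alpha> * \<alpha>"
    proof -
      have "t11 + t22 + t33 = e + 3 * \<beta>"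
        by (simp add: e_def t11_def t22_def t33_def algebra_simps)
      then show ?thesis by (simp add: e algebra_simps)
    qed
    show "t11 * t22 + t11 * t33 + t22 * t33 - t12 * c' - t23 * t32 = - 2 * \<alpha>"
    proof -
      have "t12 * c' = t11 * t22 + t11 * t33 + t22 * t33 - t23 * t32 + 2 * \<alpha>"
        unfolding t12_def using inv(2) by (metis mult.commute mult.assoc mult_1)
      then show ?thesis by simp
    qed
    show "t11 * (t22 * t33 - t23 * t32) - c' * (t12 * t33 - t13 * t32) = 1"
    proof -
      have "c' * t13 * t32 = 1 - t11 * (t22 * t33 - t23 * t32) + c' * t12 * t33"
      proof -
        have "c' * (c * s' * c * x) * (c' * s) = (c * c') * (c * c') * (s * s') * x" for x
          by (simp add: mult_ac)
        then show ?thesis unfolding t13_def t32_def by (simp add: inv)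
      qed
      then show ?thesis by (simp add: algebra_simps)
    qed
  qed
  then obtain Z where Z: "Z \<in> carrier_mat 3 3"
    "Z * Z = mat3 (t11 - \<beta>) t12 t13 c' (t22 - \<beta>) t23 0 t32 (t33 - \<beta>)" by blast
  define X where "X = mat3 1 (a' * (b12 - c * t12)) (a' * (b13 - c * t13)) 0 0 0 0 0 0"
  have c: "c * (c' * x) = x" and a: "a * (a' * x) = x" for x
    using inv by (metis mult.assoc mult_1)+
  have "a \<cdot>\<^sub>m (X * X) + c \<cdot>\<^sub>m (Z * Z) = mat3 b11 b12 b13 1 b22 b23 0 s b33"
    unfolding Z(2) X_def mat3_mult mat3_smult mat3_add
    by (intro mat3_eqI) (simp_all add: t11_def t22_def t33_def t23_def t32_def a c inv)
  then show ?thesis using Z(1) by (metis X_def mat3_carrier)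
qed

text \<open>The first column of \<open>Y\<close> is used to clear the first column of the matrix
  below the diagonal, up to the prescribed 1; its lower right block makes the entry (3,2) a
  unit.\<close>

lemma square_to_hessenberg:
  fixes b :: "'a :: comm_ring_1"
  assumes local: "\<And>x. x dvd 1 \<or> (x - b) dvd 1" and b: "b dvd 1"
  shows "\<exists>Y \<in> carrier_mat 3 3. \<exists>b11 b12 b13 b22 b23 s b33. s dvd 1 \<and>
    mat3 a11 a12 a13 a21 a22 a23 a31 a32 a33 = mat3 b11 b12 b13 1 b22 b23 0 s b33 + b \<cdot>\<^sub>m (Y * Y)"
proof -
  obtain b' where b': "b * b' = 1" using b by (metis dvdE)
  then have bb: "b * (b' * x) = x" for x by (metis mult.assoc mult_1)
  from local[of a32] show ?thesis
  proof
    assume s: "a32 dvd 1"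
    \<comment> \<open>This \<open>?Y\<close> is idempotent, so its square changes only the first
      column.\<close>
    let ?Y = "mat3 1 0 0 (b' * (a21 - 1)) 0 0 (b' * a31) 0 0"
    have "mat3 a11 a12 a13 a21 a22 a23 a31 a32 a33
        = mat3 (a11 - b) a12 a13 1 a22 a23 0 a32 a33 + b \<cdot>\<^sub>m (?Y * ?Y)"
      unfolding mat3_mult mat3_smult mat3_add
      by (intro mat3_eqI) (simp_all add: bb b')
    then show ?thesis using s mat3_carrier by metis
  next
    assume s: "(a32 - b) dvd 1"
    \<comment> \<open>The block with rows (0, 1) and (1, 1) has square with rows (1, 1) and (1, 2),
      which lowers \<open>a32\<close> by \<open>b\<close>. The first column solves the linear system
      that this block imposes.\<close>
    let ?Y = "mat3 0 0 0 (b' * (a31 - a21 + 1)) 0 1 (b' * (a21 - 1)) 1 1"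
    have "mat3 a11 a12 a13 a21 a22 a23 a31 a32 a33
        = mat3 a11 a12 a13 1 (a22 - b) (a23 - b) 0 (a32 - b) (a33 - 2 * b) + b \<cdot>\<^sub>m (?Y * ?Y)"
      unfolding mat3_mult mat3_smult mat3_add
      by (intro mat3_eqI) (simp_all add: bb distrib_left b')
    then show ?thesis using s mat3_carrier by metis
  qed
qed

lemma universal_three_units:
  fixes a :: "nat \<Rightarrow> 'a :: comm_ring_1"
  assumes local: "\<And>x b :: 'a. b dvd 1 \<Longrightarrow> x dvd 1 \<or> (x - b) dvd 1"
    and parity: "\<And>x :: 'a. 2 dvd x \<or> 2 dvd x - 1"
    and a: "a 0 dvd 1" "a 1 dvd 1" "a 2 dvd 1"
  shows "universal 3 3 a"
  unfolding universal_def
proof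
  fix A :: "'a mat"
  assume "A \<in> carrier_mat 3 3"
  then obtain a11 a12 a13 a21 a22 a23 a31 a32 a33
    where A: "A = mat3 a11 a12 a13 a21 a22 a23 a31 a32 a33" by (rule carrier_mat3)
  obtain Y b11 b12 b13 b22 b23 s b33 where Y: "Y \<in> carrier_mat 3 3" and s: "s dvd 1"
    and AY: "A = mat3 b11 b12 b13 1 b22 b23 0 s b33 + a 1 \<cdot>\<^sub>m (Y * Y)"
    using square_to_hessenberg[OF local[OF a(2)] a(2)] unfolding A by metis
  obtain X Z where XZ: "X \<in> carrier_mat 3 3" "Z \<in> carrier_mat 3 3"
    and B: "mat3 b11 b12 b13 1 b22 b23 0 s b33 = a 0 \<cdot>\<^sub>m (X * X) + a 2 \<cdot>\<^sub>m (Z * Z)"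
    using hessenberg_two_squares[OF parity a(1,3) s] by metis
  define W where "W = (\<lambda>i :: nat. if i = 0 then X else if i = 1 then Y else Z)"
  have "A = diag_form 3 3 a W"
    using Y XZ unfolding AY B
    by (subst diag_form_three) (auto simp: W_def intro!: eq_matI simp: algebra_simps)
  moreover have "\<forall>i<3. W i \<in> carrier_mat 3 3"
    using Y XZ by (simp add: W_def)
  ultimately show "\<exists>X. (\<forall>i<3. X i \<in> carrier_mat 3 3) \<and> A = diag_form 3 3 a X" by blast
qed

theorem theorem3p1:
  shows "f_min TYPE('p :: prime_card) 3 \<le> 4"
proof -
  have "universal 3 3 a" if "3 \<le> card {i. i < 3 \<and> a i dvd 1}" for a :: "nat \<Rightarrow> 'p padic_int"
  proof (rule universal_three_units)
    have "{i. i < 3 \<and> a i dvd 1} = {..<3}"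
      using that by (intro card_seteq) auto
    then have "a i dvd 1" if "i < 3" for i
      using that by blast
    then show "a 0 dvd 1" "a 1 dvd 1" "a 2 dvd 1" by simp_all
  qed (fact padic_int_unit_or_diff_unit padic_int_parity)+
  \<comment> \<open>The value 3 is itself admissible in the infimum, which gives more than the
    claimed bound.\<close>
  then have "f_min TYPE('p) 3 \<le> enat 3"
    unfolding f_min_def by (intro INF_lower) auto
  also have "\<dots> \<le> 4" by (simp add: numeral_eq_enat)
  finally show ?thesis .
qed

end
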